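(* Let $N\ge1$ and $T>0$. Let $A:\mathbb{R}^N\to\mathbb{R}^{N\times N}$ be continuous and suppose there is $B>0$ such that $|A(x)\xi|\le B|\xi|$ for all $x,\xi\in\mathbb{R}^N$. Let $h:\mathbb{R}^N\to\mathbb{R}$ satisfy $|h(y)-h(\tilde y)|\le L|y-\tilde y|$ for all $y,\tilde y\in\mathbb{R}^N$, for some constant $L$. Let $u:\mathbb{R}^N\times[0,T]\to\mathbb{R}$ be the value function $$u(y,t):=\inf\left\{\frac12\int_t^T|\alpha(s)|^2\,ds+h(x(T))\right\},$$ where the infimum is taken over all square integrable controls $\alpha:[0,T]\to\mathbb{R}^N$ and all absolutely continuous solutions $x:[t,T]\to\mathbb{R}^N$ of $\dot x(s)=A(x(s))\alpha(s)$ for a.e. $s\in(t,T)$, $x(t)=y$. Then there is $k>0$ such that for all $y\in\mathbb{R}^N$ and $t,\tilde t\in[0,T]$ $$|u(y,t)-u(y,\tilde t)|\le k|t-\tilde t|.$$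
   Context: $|\cdot|$ is the Euclidean norm on $\mathbb{R}^N$. Solutions of the controlled ODE always exist for square integrable controls but need not be unique. *)

theory Defs
  imports "HOL-Analysis.Analysis"
begin

text \<open>
  Absolute continuity of a function on an interval, in the usual epsilon-delta sense. The library
  constant \<^const>\<open>absolutely_continuous\<close> is a relation between measures and is not this notion.
\<close>

definition abs_cont_on :: "real \<Rightarrow> real \<Rightarrow> (real \<Rightarrow> 'a::real_normed_vector) \<Rightarrow> bool" where
  "abs_cont_on a b f \<longleftrightarrow>
    (\<forall>\<epsilon>>0. \<exists>\<delta>>0. \<forall>D.
       finite D \<and> (\<forall>(c, d)\<in>D. a \<le> c \<and> c < d \<and> d \<le> b) \<and>
       disjoint_family_on (\<lambda>(c, d). {c<..<d}) D \<and>
       (\<Sum>(c, d)\<in>D. d - c) < \<delta> \<longrightarrow>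
       (\<Sum>(c, d)\<in>D. norm (f d - f c)) < \<epsilon>)"

text \<open>
  Functions on \<open>[0,T]\<close> and \<open>[t,T]\<close> are represented by total functions on the reals; only their
  values on these intervals matter in what follows.
\<close>

definition square_integrable_on :: "(real \<Rightarrow> 'a::real_normed_vector) \<Rightarrow> real set \<Rightarrow> bool" where
  "square_integrable_on \<alpha> S \<longleftrightarrow>
    set_borel_measurable lebesgue S \<alpha> \<and> set_integrable lebesgue S (\<lambda>s. (norm (\<alpha> s))\<^sup>2)"

definition controlled_solution ::
  "(real^'n \<Rightarrow> real^'n^'n) \<Rightarrow> real \<Rightarrow> real^'n \<Rightarrow> real \<Rightarrow> (real \<Rightarrow> real^'n) \<Rightarrow> (real \<Rightarrow> real^'n) \<Rightarrow> bool"
  where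
  "controlled_solution A T y t \<alpha> x \<longleftrightarrow>
    abs_cont_on t T x \<and> x t = y \<and>
    (AE s in lebesgue. s \<in> {t<..<T} \<longrightarrow> (x has_vector_derivative A (x s) *v \<alpha> s) (at s))"

text \<open>
  The infimum is taken in the reals. Under the boundedness condition on \<open>A\<close> and the Lipschitz
  condition on \<open>h\<close> the set of costs is nonempty (take \<open>\<alpha> = 0\<close> and \<open>x\<close> constant) and bounded below
  for \<open>t \<in> [0,T]\<close>, so this is the genuine infimum.
\<close>

definition value_function ::
  "(real^'n \<Rightarrow> real^'n^'n) \<Rightarrow> (real^'n \<Rightarrow> real) \<Rightarrow> real \<Rightarrow> real^'n \<Rightarrow> real \<Rightarrow> real" where
  "value_function A h T y t =
    Inf {1 / 2 * (LINT s:{t..T}|lebesgue. (norm (\<alpha> s))\<^sup>2) + h (x T) | \<alpha> x.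
           square_integrable_on \<alpha> {0..T} \<and> controlled_solution A T y t \<alpha> x}"

end

theory Submission
  imports Defs
begin

text \<open>
  Let \<open>t \<le> t'\<close>. Waiting at \<open>y\<close> with zero control until \<open>t'\<close> costs nothing, so
  \<open>u(y,t) \<le> u(y,t')\<close>. Conversely, delay a trajectory from time \<open>t\<close> by \<open>d = t' - t\<close>: this drops the
  running cost over \<open>[T - d, T]\<close>, and replaces \<open>h(x(T))\<close> by \<open>h(x(T - d))\<close>, at a price of at most
  \<open>L B \<integral> |\<alpha>| \<le> \<integral> (|\<alpha>|\<^sup>2/2 + (L B)\<^sup>2/2)\<close> over that interval. The quadratic terms cancel, leaving
  \<open>(L B)\<^sup>2 d / 2\<close>; the same estimate on \<open>[t, T]\<close> bounds the costs from below.
\<close>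

section \<open>Absolute continuity and the fundamental theorem of calculus\<close>

text \<open>A monotone map that does not increase distances sends disjoint intervals to disjoint
  intervals of no larger total length, so the \<open>\<delta>\<close> of \<open>f\<close> serves
  again. The general \<open>\<phi>\<close> covers the three later uses at once: the identity
  (restriction), \<open>max t'\<close> (waiting) and \<open>\<lambda>s. s - d\<close>
  (delay).\<close>

lemma abs_cont_on_compose_mono:
  assumes f: "abs_cont_on a b f"
    and \<phi>: "\<And>s. \<lbrakk>a' \<le> s; s \<le> b'\<rbrakk> \<Longrightarrow> a \<le> \<phi> s \<and> \<phi> s \<le> b"
    and mono: "\<And>c d. c \<le> d \<Longrightarrow> \<phi> c \<le> \<phi> d"
    and contr: "\<And>c d. c \<le> d \<Longrightarrow> \<phi> d - \<phi> c \<le> d - c"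
  shows "abs_cont_on a' b' (\<lambda>s. f (\<phi> s))"
  unfolding abs_cont_on_def
proof (intro allI impI)
  fix \<epsilon> :: real
  assume "\<epsilon> > 0"
  then obtain \<delta> where "\<delta> > 0" and
    \<delta>: "\<And>D. \<lbrakk>finite D; \<forall>(c, d)\<in>D. a \<le> c \<and> c < d \<and> d \<le> b;
       disjoint_family_on (\<lambda>(c, d). {c<..<d}) D; (\<Sum>(c, d)\<in>D. d - c) < \<delta>\<rbrakk>
       \<Longrightarrow> (\<Sum>(c, d)\<in>D. norm (f d - f c)) < \<epsilon>"
    using f unfolding abs_cont_on_def by meson
  have "(\<Sum>(c, d)\<in>D. norm (f (\<phi> d) - f (\<phi> c))) < \<epsilon>"
    if fin: "finite D" and D: "\<forall>(c, d)\<in>D. a' \<le> c \<and> c < d \<and> d \<le> b'"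
      and disj: "disjoint_family_on (\<lambda>(c, d). {c<..<d}) D" and small: "(\<Sum>(c, d)\<in>D. d - c) < \<delta>" for D
  proof -
    \<comment> \<open>Intervals that \<open>\<phi>\<close> collapses to a point are set aside:
      \<open>abs_cont_on\<close> admits only nondegenerate intervals, and several of them could have
      the same image. They contribute zero to the sum.\<close>
    define E where "E = {(c, d) \<in> D. \<phi> c < \<phi> d}"
    define m where "m = (\<lambda>(c, d). (\<phi> c, \<phi> d))"
    have ED: "E \<subseteq> D" by (auto simp: E_def)
    then have finE: "finite E" using fin finite_subset by blast
    have E: "a' \<le> c \<and> c < d \<and> d \<le> b' \<and> \<phi> c < \<phi> d" if "(c, d) \<in> E" for c d
      using that D by (auto simp: E_def)
    have sep: "\<phi> d \<le> \<phi> c' \<or> \<phi> d' \<le> \<phi> c"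
      if E': "(c, d) \<in> E" "(c', d') \<in> E" "(c, d) \<noteq> (c', d')" for c d c' d'
    proof -
      have "{c<..<d} \<inter> {c'<..<d'} = {}"
        using disjoint_family_onD[OF disj _ _ E'(3)] ED E'(1,2) by auto
      then have "d \<le> c' \<or> d' \<le> c"
        using E[OF E'(1)] E[OF E'(2)] by (auto simp: min_def max_def split: if_splits)
      then show ?thesis using mono by auto
    qed
    have inj: "inj_on m E"
    proof (rule inj_onI, rule ccontr)
      fix i j assume ij: "i \<in> E" "j \<in> E" "m i = m j" "i \<noteq> j"
      obtain c d c' d' where "i = (c, d)" "j = (c', d')" by (cases i; cases j)
      then show False using ij sep[of c d c' d'] E[of c d] by (auto simp: m_def)
    qed
    have "(\<Sum>(c, d)\<in>m ` E. norm (f d - f c)) < \<epsilon>"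
    proof (rule \<delta>)
      show "finite (m ` E)" using finE by simp
      show "\<forall>(c, d)\<in>m ` E. a \<le> c \<and> c < d \<and> d \<le> b"
      proof (clarsimp simp: m_def)
        fix c d assume "(c, d) \<in> E"
        then show "a \<le> \<phi> c \<and> \<phi> c < \<phi> d \<and> \<phi> d \<le> b" using E[of c d] \<phi>[of c] \<phi>[of d] by auto
      qed
      show "disjoint_family_on (\<lambda>(c, d). {c<..<d}) (m ` E)"
        unfolding disjoint_family_on_def
      proof (intro ballI impI)
        fix i j
        assume "i \<in> m ` E" "j \<in> m ` E" "i \<noteq> j"
        then obtain c d c' d' where q: "(c, d) \<in> E" "(c', d') \<in> E"
          and ij: "i = (\<phi> c, \<phi> d)" "j = (\<phi> c', \<phi> d')"
          by (auto simp: m_def)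
        then have "(c, d) \<noteq> (c', d')" using \<open>i \<noteq> j\<close> by auto
        from sep[OF q this]
        show "(case i of (c, d) \<Rightarrow> {c<..<d}) \<inter> (case j of (c, d) \<Rightarrow> {c<..<d}) = {}"
          by (auto simp: ij)
      qed
      have "(\<Sum>(c, d)\<in>m ` E. d - c) = (\<Sum>(c, d)\<in>E. \<phi> d - \<phi> c)"
        by (subst sum.reindex[OF inj]) (simp add: m_def case_prod_unfold)
      also have "\<dots> \<le> (\<Sum>(c, d)\<in>E. d - c)"
      proof (rule sum_mono, clarify)
        fix c d assume "(c, d) \<in> E"
        then show "\<phi> d - \<phi> c \<le> d - c" using E[of c d] contr[of c d] by simp
      qed
      also have "\<dots> \<le> (\<Sum>(c, d)\<in>D. d - c)"
        using D by (intro sum_mono2 fin ED) auto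
      finally show "(\<Sum>(c, d)\<in>m ` E. d - c) < \<delta>" using small by simp
    qed
    also have "(\<Sum>(c, d)\<in>m ` E. norm (f d - f c)) = (\<Sum>(c, d)\<in>E. norm (f (\<phi> d) - f (\<phi> c)))"
      by (subst sum.reindex[OF inj]) (simp add: m_def case_prod_unfold)
    also have "\<dots> = (\<Sum>(c, d)\<in>D. norm (f (\<phi> d) - f (\<phi> c)))"
    proof (rule sum.mono_neutral_left[OF fin ED], clarify)
      fix c d assume cd: "(c, d) \<in> D" "(c, d) \<notin> E"
      then have "\<phi> c \<le> \<phi> d" using D mono[of c d] by auto
      then have "\<phi> c = \<phi> d" using cd by (auto simp: E_def)
      then show "norm (f (\<phi> d) - f (\<phi> c)) = 0" by simp
    qed
    finally show ?thesis .
  qed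
  then show "\<exists>\<delta>>0. \<forall>D. finite D \<and> (\<forall>(c, d)\<in>D. a' \<le> c \<and> c < d \<and> d \<le> b') \<and>
       disjoint_family_on (\<lambda>(c, d). {c<..<d}) D \<and> (\<Sum>(c, d)\<in>D. d - c) < \<delta>
       \<longrightarrow> (\<Sum>(c, d)\<in>D. norm (f (\<phi> d) - f (\<phi> c))) < \<epsilon>"
    using \<open>\<delta> > 0\<close> by blast
qed

text \<open>Carries absolute continuity over to the tagged divisions of the gauge integral. The
  interiors of the intervals are disjoint and lie in \<open>U\<close>, so their total length is at
  most the measure of \<open>U\<close>, and the \<open>\<delta>\<close> of the definition can be
  kept.\<close>

lemma abs_cont_on_tagged_sum_less:
  fixes f :: "real \<Rightarrow> 'a::real_normed_vector"
  assumes "abs_cont_on a b f" "\<epsilon> > 0"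
  shows "\<exists>\<delta>>0. \<forall>p U. p tagged_partial_division_of {a..b} \<and> (\<forall>(x, K)\<in>p. K \<subseteq> U) \<and>
      U \<in> lmeasurable \<and> measure lebesgue U < \<delta>
      \<longrightarrow> (\<Sum>(x, K)\<in>p. norm (f (Sup K) - f (Inf K))) < \<epsilon>"
proof -
  obtain \<delta> where "\<delta> > 0" and
    \<delta>: "\<And>D. \<lbrakk>finite D; \<forall>(c, d)\<in>D. a \<le> c \<and> c < d \<and> d \<le> b;
       disjoint_family_on (\<lambda>(c, d). {c<..<d}) D; (\<Sum>(c, d)\<in>D. d - c) < \<delta>\<rbrakk>
       \<Longrightarrow> (\<Sum>(c, d)\<in>D. norm (f d - f c)) < \<epsilon>"
    using assms unfolding abs_cont_on_def by meson
  show ?thesis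
  proof (intro exI[of _ \<delta>] conjI \<open>\<delta> > 0\<close> allI impI, elim conjE)
    fix p U
    assume p: "p tagged_partial_division_of {a..b}" and KU: "\<forall>(x, K)\<in>p. K \<subseteq> U"
      and U: "U \<in> lmeasurable" "measure lebesgue U < \<delta>"
    \<comment> \<open>One-point intervals may occur in \<open>p\<close> but not in
      \<open>abs_cont_on\<close>; their increments vanish. On the rest, equal endpoints mean equal
      nonempty interiors, which forces the tagged intervals to coincide.\<close>
    define q where "q = {(x, K) \<in> p. interior K \<noteq> {}}"
    define ends where "ends = (\<lambda>(x::real, K::real set). (Inf K, Sup K))"
    have "finite p" using p by (simp add: tagged_partial_division_of_def)
    then have finq: "finite q" unfolding q_def by (rule rev_finite_subset) auto
    have K_eq: "Inf K \<le> Sup K \<and> K = {Inf K..Sup K}" if xK: "(x, K) \<in> p" for x K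
    proof -
      obtain u v where "K = {u..v}"
        using tagged_partial_division_ofD(4)[OF p xK] by auto
      moreover have "x \<in> K" using tagged_partial_division_ofD(2)[OF p xK] .
      ultimately show ?thesis by auto
    qed
    have int_q: "Inf K < Sup K \<and> interior K = {Inf K<..<Sup K} \<and> K \<subseteq> {a..b}" if xK: "(x, K) \<in> q" for x K
    proof -
      have "(x, K) \<in> p" "interior K \<noteq> {}" using xK by (auto simp: q_def)
      moreover have "interior K = {Inf K<..<Sup K}"
        using K_eq[OF \<open>(x, K) \<in> p\<close>] interior_atLeastAtMost_real by metis
      ultimately show ?thesis
        using tagged_partial_division_ofD(3)[OF p \<open>(x, K) \<in> p\<close>] by auto
    qed
    have disj_q: "interior K \<inter> interior K' = {}" if "(x, K) \<in> q" "(x', K') \<in> q" "(x, K) \<noteq> (x', K')" for x K x' K'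
      using that by (intro tagged_partial_division_ofD(5)[OF p]) (auto simp: q_def)
    have inj: "inj_on ends q"
    proof (rule inj_onI, clarify)
      fix x K x' K'
      assume q: "(x, K) \<in> q" "(x', K') \<in> q" and eq: "ends (x, K) = ends (x', K')"
      have "interior K = interior K'" "interior K \<noteq> {}"
        using int_q[OF q(1)] int_q[OF q(2)] eq by (auto simp: ends_def)
      then show "x = x' \<and> K = K'" using disj_q[OF q] by auto
    qed
    have "(\<Sum>(c, d)\<in>ends ` q. norm (f d - f c)) < \<epsilon>"
    proof (rule \<delta>)
      show "finite (ends ` q)" using finq by simp
      show "\<forall>(c, d)\<in>ends ` q. a \<le> c \<and> c < d \<and> d \<le> b"
      proof (clarsimp simp: ends_def)
        fix x K assume xK: "(x, K) \<in> q"
        then have "(x, K) \<in> p" by (simp add: q_def)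
        then have "Inf K \<in> K" "Sup K \<in> K" using K_eq by (metis atLeastAtMost_iff order_refl)+
        then show "a \<le> Inf K \<and> Inf K < Sup K \<and> Sup K \<le> b" using int_q[OF xK] by auto
      qed
      show disj: "disjoint_family_on (\<lambda>(c, d). {c<..<d}) (ends ` q)"
        unfolding disjoint_family_on_def
      proof (intro ballI impI)
        fix i j
        assume "i \<in> ends ` q" "j \<in> ends ` q" "i \<noteq> j"
        then obtain x K x' K' where q: "(x, K) \<in> q" "(x', K') \<in> q"
          and ij: "i = (Inf K, Sup K)" "j = (Inf K', Sup K')"
          by (auto simp: ends_def)
        then have "(x, K) \<noteq> (x', K')" using \<open>i \<noteq> j\<close> by auto
        from disj_q[OF q this]
        show "(case i of (c, d) \<Rightarrow> {c<..<d}) \<inter> (case j of (c, d) \<Rightarrow> {c<..<d}) = {}"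
          using int_q[OF q(1)] int_q[OF q(2)] by (simp add: ij)
      qed
      \<comment> \<open>Reading lengths as measures turns the sum into the measure of a disjoint
        union contained in \<open>U\<close>.\<close>
      have "(\<Sum>(c, d)\<in>ends ` q. d - c) = (\<Sum>cd\<in>ends ` q. measure lebesgue (case cd of (c, d) \<Rightarrow> {c<..<d}))"
      proof (rule sum.cong[OF refl])
        fix i assume "i \<in> ends ` q"
        then obtain x K where "(x, K) \<in> q" "i = (Inf K, Sup K)" by (auto simp: ends_def)
        then show "(case i of (c, d) \<Rightarrow> d - c) = measure lebesgue (case i of (c, d) \<Rightarrow> {c<..<d})"
          using int_q[of x K] by simp
      qed
      also have "\<dots> = measure lebesgue (\<Union>cd\<in>ends ` q. case cd of (c, d) \<Rightarrow> {c<..<d})"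
        using finq disj
        by (intro measure_UNION'[symmetric])
           (auto simp: disjoint_family_on_def pairwise_def disjnt_def)
      also have "\<dots> \<le> measure lebesgue U"
      proof (rule measure_mono_fmeasurable)
        show "(\<Union>cd\<in>ends ` q. case cd of (c, d) \<Rightarrow> {c<..<d}) \<subseteq> U"
        proof (clarsimp simp: ends_def)
          fix x K z assume "(x, K) \<in> q" "Inf K < z" "z < Sup K"
          then have "z \<in> K" "(x, K) \<in> p"
            using int_q[of x K] interior_subset[of K] by (auto simp: q_def)
          then show "z \<in> U" using KU by auto
        qed
        show "(\<Union>cd\<in>ends ` q. case cd of (c, d) \<Rightarrow> {c<..<d}) \<in> sets lebesgue"
          using finq by (intro sets.finite_UN) auto
      qed (use U in auto)
      finally show "(\<Sum>(c, d)\<in>ends ` q. d - c) < \<delta>" using U by simp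
    qed
    also have "(\<Sum>(c, d)\<in>ends ` q. norm (f d - f c)) = (\<Sum>(x, K)\<in>q. norm (f (Sup K) - f (Inf K)))"
      by (subst sum.reindex[OF inj]) (simp add: ends_def case_prod_unfold)
    also have "\<dots> = (\<Sum>(x, K)\<in>p. norm (f (Sup K) - f (Inf K)))"
    proof (rule sum.mono_neutral_left)
      show "\<forall>i\<in>p - q. (case i of (x, K) \<Rightarrow> norm (f (Sup K) - f (Inf K))) = 0"
      proof (clarify)
        fix x K assume xK: "(x, K) \<in> p" "(x, K) \<notin> q"
        then have "{Inf K<..<Sup K} = {}"
          using K_eq[OF xK(1)] interior_atLeastAtMost_real[of "Inf K" "Sup K"] by (auto simp: q_def)
        then have "Inf K = Sup K" using K_eq[OF xK(1)] by auto
        then show "norm (f (Sup K) - f (Inf K)) = 0" by simp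
      qed
    qed (use \<open>finite p\<close> in \<open>auto simp: q_def\<close>)
    finally show "(\<Sum>(x, K)\<in>p. norm (f (Sup K) - f (Inf K))) < \<epsilon>" .
  qed
qed

text \<open>
  A gauge that keeps the intervals tagged in the null set \<open>N\<close> inside a small open neighbourhood of
  \<open>N\<close> makes their contribution small by absolute continuity.
\<close>
lemma fundamental_theorem_of_calculus_abs_cont:
  fixes f :: "real \<Rightarrow> 'a::banach"
  assumes "a \<le> b" and ac: "abs_cont_on a b f" and N: "negligible N"
    and vecd: "\<And>s. s \<in> {a..b} - N \<Longrightarrow> (f has_vector_derivative f' s) (at s within {a..b})"
  shows "(f' has_integral (f b - f a)) {a..b}"
proof -
  \<comment> \<open>Nothing is known about \<open>f'\<close> on \<open>N\<close>. With the value 0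
    there, a term tagged in \<open>N\<close> is just an increment of \<open>f\<close>; the change is
    undone at the end because \<open>N\<close> is negligible.\<close>
  define g where "g s = (if s \<in> N then 0 else f' s)" for s
  have "(g has_integral (f b - f a)) (cbox a b)"
    unfolding has_integral
  proof (intro allI impI)
    fix e0 :: real
    assume "e0 > 0"
    \<comment> \<open>The summand 1 keeps the denominator positive when
      \<open>a = b\<close>.\<close>
    define e where "e = e0 / (2 * (b - a + 1))"
    have "e > 0" using \<open>e0 > 0\<close> \<open>a \<le> b\<close> by (simp add: e_def)
    have e_ba: "e * (b - a) \<le> e0 / 2"
      using \<open>e0 > 0\<close> \<open>a \<le> b\<close> by (simp add: e_def field_simps)
    have "e0 / 2 > 0" using \<open>e0 > 0\<close> by simp
    from abs_cont_on_tagged_sum_less[OF ac this]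
    obtain \<delta> where "\<delta> > 0" and
      \<delta>: "\<forall>p U. p tagged_partial_division_of {a..b} \<and> (\<forall>(x, K)\<in>p. K \<subseteq> U) \<and>
        U \<in> lmeasurable \<and> measure lebesgue U < \<delta>
        \<longrightarrow> (\<Sum>(x, K)\<in>p. norm (f (Sup K) - f (Inf K))) < e0 / 2"
      by (elim exE conjE)
    obtain U where U: "open U" "N \<subseteq> U" "U \<in> lmeasurable" "measure lebesgue U < \<delta>"
    proof -
      have Nl: "N \<in> lmeasurable" "measure lebesgue N = 0"
        using N negligible_iff_measure by auto
      obtain V where V: "open V" "N \<subseteq> V" "V - N \<in> lmeasurable" "emeasure lebesgue (V - N) < ennreal \<delta>"
        using sets_lebesgue_outer_open[of N \<delta>] Nl \<open>\<delta> > 0\<close> by (metis fmeasurableD)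
      have V_eq: "V = (V - N) \<union> N" using V by auto
      have "V \<in> lmeasurable" using V Nl V_eq by (metis fmeasurable.Un)
      moreover have "measure lebesgue V \<le> measure lebesgue (V - N) + measure lebesgue N"
        using V Nl by (metis V_eq measure_Un_le fmeasurableD)
      moreover have "measure lebesgue (V - N) < \<delta>"
        using V(3,4) \<open>\<delta> > 0\<close> by (simp add: emeasure_eq_measure2 ennreal_less_iff)
      ultimately show ?thesis using that V Nl by simp
    qed
    \<comment> \<open>The radius comes from the linear approximation of \<open>f\<close> at points
      of \<open>{a..b}\<close> off \<open>N\<close> and from the openness of \<open>U\<close> at
      points of \<open>N\<close>; elsewhere any radius will do.\<close>
    have "\<exists>d>0. (s \<in> {a..b} - N \<longrightarrow>
        (\<forall>y\<in>{a..b}. norm (y - s) < d \<longrightarrow> norm (f y - f s - (y - s) *\<^sub>R f' s) \<le> e * norm (y - s)))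
        \<and> (s \<in> N \<longrightarrow> ball s d \<subseteq> U)" for s
    proof (cases "s \<in> N")
      case True
      then show ?thesis using U by (auto simp: open_contains_ball)
    next
      case False
      then show ?thesis
        using vecd[of s, unfolded has_vector_derivative_def has_derivative_within_alt] \<open>e > 0\<close>
        by (cases "s \<in> {a..b}") (auto intro: zero_less_one)
    qed
    then obtain d where d: "\<And>s. 0 < d s"
      "\<And>s y. \<lbrakk>s \<in> {a..b}; s \<notin> N; y \<in> {a..b}; norm (y - s) < d s\<rbrakk>
         \<Longrightarrow> norm (f y - f s - (y - s) *\<^sub>R f' s) \<le> e * norm (y - s)"
      "\<And>s. s \<in> N \<Longrightarrow> ball s (d s) \<subseteq> U"
      by (metis DiffI)
    show "\<exists>\<gamma>. gauge \<gamma> \<and> (\<forall>p. p tagged_division_of cbox a b \<and> \<gamma> fine p \<longrightarrow>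
      norm ((\<Sum>(x, K)\<in>p. measure lborel K *\<^sub>R g x) - (f b - f a)) < e0)"
    proof (intro exI conjI allI impI)
      show "gauge (\<lambda>s. ball s (d s))"
        using d(1) gauge_ball_dependent by blast
    next
      fix p
      assume "p tagged_division_of cbox a b \<and> (\<lambda>s. ball s (d s)) fine p"
      then have ptag: "p tagged_division_of {a..b}" and fine: "(\<lambda>s. ball s (d s)) fine p" by auto
      have fin: "finite p" using ptag by (rule tagged_division_of_finite)
      define q where "q = {(x, K) \<in> p. x \<in> N}"
      have qp: "q \<subseteq> p" by (auto simp: q_def)
      have ba: "b - a = (\<Sum>(x, K)\<in>p. Sup K - Inf K)" "f b - f a = (\<Sum>(x, K)\<in>p. f (Sup K) - f (Inf K))"
        using additive_tagged_division_1[where f = "\<lambda>x. x"] additive_tagged_division_1[where f = f]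
              \<open>a \<le> b\<close> ptag by auto
      let ?t = "\<lambda>(x, K). measure lborel K *\<^sub>R g x - (f (Sup K) - f (Inf K))"
      have K: "\<exists>u v. u \<le> v \<and> K = {u..v} \<and> x \<in> K \<and> K \<subseteq> {a..b} \<and> K \<subseteq> ball x (d x)"
        if xK: "(x, K) \<in> p" for x K
      proof -
        obtain u v where "K = {u..v}" using tagged_division_ofD(4)[OF ptag xK] by auto
        then show ?thesis
          using tagged_division_ofD(2,3)[OF ptag xK] fineD[OF fine xK] by fastforce
      qed
      \<comment> \<open>Straddling: the tag lies between the endpoints \<open>u\<close> and
        \<open>v\<close>, so the two approximation errors add up to
        \<open>e * (\<bar>u - x\<bar> + \<bar>v - x\<bar>) = e * (v - u)\<close>.\<close>
      have good: "norm (measure lborel K *\<^sub>R g x - (f (Sup K) - f (Inf K))) \<le> e * (Sup K - Inf K)"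
        if xK: "(x, K) \<in> p" "x \<notin> N" for x K
      proof -
        obtain u v where uv: "u \<le> v" "K = {u..v}" "x \<in> {u..v}" "{u..v} \<subseteq> {a..b}" "{u..v} \<subseteq> ball x (d x)"
          using K[OF xK(1)] by auto
        have "norm ((v - u) *\<^sub>R f' x - (f v - f u))
            = norm ((f u - f x - (u - x) *\<^sub>R f' x) - (f v - f x - (v - x) *\<^sub>R f' x))"
          by (auto simp: algebra_simps)
        also have "\<dots> \<le> norm (f u - f x - (u - x) *\<^sub>R f' x) + norm (f v - f x - (v - x) *\<^sub>R f' x)"
          by (rule norm_triangle_ineq4)
        also have "\<dots> \<le> e * norm (u - x) + e * norm (v - x)"
        proof (rule add_mono)
          have "u \<in> {u..v}" "v \<in> {u..v}" using uv(1) by auto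
          with uv(5) have "u \<in> ball x (d x)" "v \<in> ball x (d x)" by blast+
          then have "norm (u - x) < d x" "norm (v - x) < d x" by (auto simp: dist_real_def)
          then show "norm (f u - f x - (u - x) *\<^sub>R f' x) \<le> e * norm (u - x)"
            "norm (f v - f x - (v - x) *\<^sub>R f' x) \<le> e * norm (v - x)"
            using d(2)[of x u] d(2)[of x v] uv xK(2) by auto
        qed
        also have "\<dots> = e * (v - u)" using uv by (simp add: algebra_simps)
        finally show ?thesis using uv xK(2) by (simp add: g_def)
      qed
      \<comment> \<open>The error is split by tags: those in \<open>N\<close> are handled by
        absolute continuity, the others by summing the straddle bound to
        \<open>e * (b - a)\<close>.\<close>
      have "(\<Sum>(x, K)\<in>q. norm (f (Sup K) - f (Inf K))) < e0 / 2"
      proof (rule \<delta>[rule_format, of _ U], intro conjI U(3,4))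
        show "q tagged_partial_division_of {a..b}"
          using ptag qp by (meson tagged_division_of_def tagged_partial_division_subset)
        show "\<forall>(x, K)\<in>q. K \<subseteq> U"
        proof clarify
          fix x K z assume "(x, K) \<in> q" "z \<in> K"
          then have "(x, K) \<in> p" "x \<in> N" by (auto simp: q_def)
          with K[of x K] d(3)[of x] \<open>z \<in> K\<close> show "z \<in> U" by auto
        qed
      qed
      moreover have "(\<Sum>i\<in>q. norm (?t i)) = (\<Sum>(x, K)\<in>q. norm (f (Sup K) - f (Inf K)))"
        by (rule sum.cong) (auto simp: q_def g_def norm_minus_commute)
      moreover have "(\<Sum>i\<in>p - q. norm (?t i)) \<le> e0 / 2"
      proof -
        have "(\<Sum>i\<in>p - q. norm (?t i)) \<le> (\<Sum>i\<in>p - q. e * (case i of (x, K) \<Rightarrow> Sup K - Inf K))"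
          using good by (intro sum_mono) (auto simp: q_def)
        also have "\<dots> \<le> (\<Sum>i\<in>p. e * (case i of (x, K) \<Rightarrow> Sup K - Inf K))"
          using fin K \<open>e > 0\<close> by (intro sum_mono2) fastforce+
        also have "\<dots> = e * (b - a)" by (simp add: ba(1) sum_distrib_left)
        finally show ?thesis using e_ba by linarith
      qed
      moreover have "(\<Sum>i\<in>p. norm (?t i)) = (\<Sum>i\<in>p - q. norm (?t i)) + (\<Sum>i\<in>q. norm (?t i))"
        by (rule sum.subset_diff[OF qp fin])
      moreover have "norm ((\<Sum>(x, K)\<in>p. measure lborel K *\<^sub>R g x) - (f b - f a)) = norm (\<Sum>i\<in>p. ?t i)"
        by (simp add: ba(2) sum_subtractf[symmetric] case_prod_unfold)
      moreover have "norm (\<Sum>i\<in>p. ?t i) \<le> (\<Sum>i\<in>p. norm (?t i))"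
        by (rule norm_sum)
      ultimately show "norm ((\<Sum>(x, K)\<in>p. measure lborel K *\<^sub>R g x) - (f b - f a)) < e0"
        by linarith
    qed
  qed
  then have "(g has_integral (f b - f a)) {a..b}" by simp
  then show ?thesis
    by (rule has_integral_spike[OF N, rotated]) (auto simp: g_def)
qed

section \<open>Trajectories in integral form and the bound on their increments\<close>

lemma AE_lebesgue_iff_negligible:
  "(AE s in lebesgue. P s) \<longleftrightarrow> (\<exists>N. negligible N \<and> (\<forall>s. s \<notin> N \<longrightarrow> P s))"
proof
  assume "AE s in lebesgue. P s"
  then obtain N where "N \<in> null_sets lebesgue" "{s \<in> space lebesgue. \<not> P s} \<subseteq> N"
    unfolding eventually_ae_filter by blast
  then show "\<exists>N. negligible N \<and> (\<forall>s. s \<notin> N \<longrightarrow> P s)"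
    by (intro exI[of _ N]) (auto simp: negligible_iff_null_sets)
next
  assume "\<exists>N. negligible N \<and> (\<forall>s. s \<notin> N \<longrightarrow> P s)"
  then show "AE s in lebesgue. P s"
    by (auto simp: negligible_iff_null_sets intro: AE_I')
qed

text \<open>The integral form of the equation, by the fundamental theorem above, which also supplies
  the integrability of the right-hand side. Arbitrary subintervals are allowed because increments
  are later estimated both on \<open>{t..T}\<close> and on \<open>{T - d..T}\<close>.\<close>

lemma controlled_solution_has_integral:
  assumes sol: "controlled_solution A T y t \<alpha> x" and ab: "t \<le> a" "a \<le> b" "b \<le> T"
  shows "((\<lambda>s. A (x s) *v \<alpha> s) has_integral (x b - x a)) {a..b}"
proof -
  have ac: "abs_cont_on t T x" using sol by (simp add: controlled_solution_def)
  obtain N where N: "negligible N"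
    "\<And>s. \<lbrakk>s \<notin> N; s \<in> {t<..<T}\<rbrakk> \<Longrightarrow> (x has_vector_derivative A (x s) *v \<alpha> s) (at s)"
    using sol unfolding controlled_solution_def AE_lebesgue_iff_negligible by blast
  show ?thesis
  proof (rule fundamental_theorem_of_calculus_abs_cont)
    show "a \<le> b" by fact
    show "abs_cont_on a b x"
      by (rule abs_cont_on_compose_mono[OF ac, where \<phi> = "\<lambda>s. s"]) (use ab in auto)
    \<comment> \<open>The equation is given only on the open interval, so its endpoints join the
      exceptional set.\<close>
    show "negligible (N \<union> {t, T})" using N(1) by simp
    show "(x has_vector_derivative A (x s) *v \<alpha> s) (at s within {a..b})"
      if "s \<in> {a..b} - (N \<union> {t, T})" for s
      by (rule has_vector_derivative_at_within[OF N(2)]) (use that ab in auto)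
  qed
qed

lemma square_integrable_on_subinterval:
  assumes "square_integrable_on \<alpha> S" "{a..b::real} \<subseteq> S"
  shows "set_integrable lebesgue {a..b} (\<lambda>s. (norm (\<alpha> s))\<^sup>2)"
  using assms unfolding square_integrable_on_def by (auto intro: set_integrable_subset)

text \<open>Young's inequality under the integral. It is weighted so that the quadratic term has the
  factor 1/2 of the running cost and can cancel against it.\<close>

lemma controlled_solution_increment_le:
  fixes A :: "real^'n \<Rightarrow> real^'n^'n"
  assumes bound: "\<And>x \<xi>. norm (A x *v \<xi>) \<le> B * norm \<xi>" and "L \<ge> 0"
    and sol: "controlled_solution A T y t \<alpha> x" and \<alpha>: "square_integrable_on \<alpha> {0..T}"
    and ab: "0 \<le> t" "t \<le> a" "a \<le> b" "b \<le> T"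
  shows "L * norm (x b - x a)
    \<le> 1 / 2 * (LINT s:{a..b}|lebesgue. (norm (\<alpha> s))\<^sup>2) + (L * B)\<^sup>2 / 2 * (b - a)"
proof -
  let ?g = "\<lambda>s. 1 / 2 * (norm (\<alpha> s))\<^sup>2 + (L * B)\<^sup>2 / 2"
  have "set_integrable lebesgue {a..b} (\<lambda>s. (norm (\<alpha> s))\<^sup>2)"
    using ab by (intro square_integrable_on_subinterval[OF \<alpha>]) auto
  then have "((\<lambda>s. (norm (\<alpha> s))\<^sup>2) has_integral (LINT s:{a..b}|lebesgue. (norm (\<alpha> s))\<^sup>2)) {a..b}"
    by (rule has_integral_set_lebesgue)
  then have g: "(?g has_integral (1 / 2 * (LINT s:{a..b}|lebesgue. (norm (\<alpha> s))\<^sup>2)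
      + (L * B)\<^sup>2 / 2 * (b - a))) {a..b}"
    using has_integral_const_real[of "(L * B)\<^sup>2 / 2" a b] ab
    by (intro has_integral_add has_integral_mult_right) (auto simp: mult.commute)
  have f: "((\<lambda>s. L *\<^sub>R (A (x s) *v \<alpha> s)) has_integral (L *\<^sub>R (x b - x a))) {a..b}"
    using controlled_solution_has_integral[OF sol] ab by (intro has_integral_cmul) auto
  have "norm (L *\<^sub>R (A (x s) *v \<alpha> s)) \<le> ?g s" for s
  proof -
    have "norm (L *\<^sub>R (A (x s) *v \<alpha> s)) \<le> (L * B) * norm (\<alpha> s)"
      using mult_left_mono[OF bound \<open>L \<ge> 0\<close>, of "x s" "\<alpha> s"] \<open>L \<ge> 0\<close> by (simp add: mult.assoc)
    \<comment> \<open>This is \<open>(norm (\<alpha> s) - L * B)\<^sup>2 \<ge> 0\<close>, expanded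
      and halved.\<close>
    also have "\<dots> \<le> ?g s"
      using zero_le_power2[of "norm (\<alpha> s) - L * B"] by (simp add: power2_diff algebra_simps)
    finally show ?thesis .
  qed
  then have "norm (integral {a..b} (\<lambda>s. L *\<^sub>R (A (x s) *v \<alpha> s))) \<le> integral {a..b} ?g"
    using f g by (intro integral_norm_bound_integral) auto
  then show ?thesis
    using \<open>L \<ge> 0\<close> unfolding integral_unique[OF f] integral_unique[OF g] by simp
qed

section \<open>Waiting and delayed trajectories\<close>

text \<open>A zero control gives zero velocity, so the state may rest at \<open>x t' = y\<close>
  before \<open>t'\<close>. Precomposing with \<open>max t'\<close> describes the rest phase and the
  motion by one formula.\<close>

lemma controlled_solution_wait:
  fixes A :: "real^'n \<Rightarrow> real^'n^'n"
  assumes sol: "controlled_solution A T y t' \<alpha> x" and "t \<le> t'" "t' \<le> T"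
  shows "controlled_solution A T y t (\<lambda>s. indicat_real {t'..} s *\<^sub>R \<alpha> s) (\<lambda>s. x (max t' s))"
  unfolding controlled_solution_def
proof (intro conjI)
  have ac: "abs_cont_on t' T x" using sol by (simp add: controlled_solution_def)
  show "abs_cont_on t T (\<lambda>s. x (max t' s))"
    by (rule abs_cont_on_compose_mono[OF ac, where \<phi> = "max t'"]) (use \<open>t' \<le> T\<close> in auto)
  show "x (max t' t) = y"
    using sol \<open>t \<le> t'\<close> by (simp add: controlled_solution_def max_def)
  obtain N where N: "negligible N"
    "\<And>s. \<lbrakk>s \<notin> N; s \<in> {t'<..<T}\<rbrakk> \<Longrightarrow> (x has_vector_derivative A (x s) *v \<alpha> s) (at s)"
    using sol unfolding controlled_solution_def AE_lebesgue_iff_negligible by blast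
  have "((\<lambda>s. x (max t' s)) has_vector_derivative
      A (x (max t' s)) *v (indicat_real {t'..} s *\<^sub>R \<alpha> s)) (at s)"
    \<comment> \<open>The two phases may meet in a kink at \<open>t'\<close>, which is therefore
      excluded.\<close>
    if s: "s \<notin> insert t' N" "s \<in> {t<..<T}" for s
  proof (cases "s < t'")
    case True
    have "((\<lambda>s. x t') has_vector_derivative 0) (at s)" by simp
    then have "((\<lambda>s. x (max t' s)) has_vector_derivative 0) (at s)"
      by (rule has_vector_derivative_transform_within_open[of _ _ _ "{..<t'}"]) (use True in auto)
    then show ?thesis using True by simp
  next
    case False
    then have "s > t'" using s by auto
    have "(x has_vector_derivative A (x s) *v \<alpha> s) (at s)"
      using N(2) s \<open>s > t'\<close> by auto
    then have "((\<lambda>s. x (max t' s)) has_vector_derivative A (x s) *v \<alpha> s) (at s)"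
      by (rule has_vector_derivative_transform_within_open[of _ _ _ "{t'<..}"]) (use \<open>s > t'\<close> in auto)
    then show ?thesis using \<open>s > t'\<close> by simp
  qed
  moreover have "negligible (insert t' N)" using N(1) by simp
  ultimately show "AE s in lebesgue. s \<in> {t<..<T} \<longrightarrow> ((\<lambda>s. x (max t' s)) has_vector_derivative
      A (x (max t' s)) *v (indicat_real {t'..} s *\<^sub>R \<alpha> s)) (at s)"
    unfolding AE_lebesgue_iff_negligible by blast
qed

text \<open>The system is autonomous: \<open>A\<close> sees time only through the state, so
  solutions can be translated. Prescribing \<open>\<beta>\<close> only between \<open>t + d\<close>
  and \<open>T\<close> leaves room for a cut-off elsewhere.\<close>

lemma controlled_solution_delay:
  fixes A :: "real^'n \<Rightarrow> real^'n^'n"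
  assumes sol: "controlled_solution A T y t \<alpha> x" and "d \<ge> 0"
    and \<beta>: "\<And>s. t + d < s \<Longrightarrow> s < T \<Longrightarrow> \<beta> s = \<alpha> (s - d)"
  shows "controlled_solution A T y (t + d) \<beta> (\<lambda>s. x (s - d))"
  unfolding controlled_solution_def
proof (intro conjI)
  have ac: "abs_cont_on t T x" using sol by (simp add: controlled_solution_def)
  show "abs_cont_on (t + d) T (\<lambda>s. x (s - d))"
    by (rule abs_cont_on_compose_mono[OF ac, where \<phi> = "\<lambda>s. s - d"]) (use \<open>d \<ge> 0\<close> in auto)
  show "x (t + d - d) = y"
    using sol by (simp add: controlled_solution_def)
  obtain N where N: "negligible N"
    "\<And>s. \<lbrakk>s \<notin> N; s \<in> {t<..<T}\<rbrakk> \<Longrightarrow> (x has_vector_derivative A (x s) *v \<alpha> s) (at s)"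
    using sol unfolding controlled_solution_def AE_lebesgue_iff_negligible by blast
  have "((\<lambda>s. x (s - d)) has_vector_derivative A (x (s - d)) *v \<beta> s) (at s)"
    \<comment> \<open>The exceptional set moves along with the trajectory and stays
      negligible.\<close>
    if s: "s \<notin> (+) d ` N" "s \<in> {t + d<..<T}" for s
  proof -
    have "s - d \<notin> N" using s(1) by (metis add.commute diff_add_cancel image_eqI)
    then have "(x has_vector_derivative A (x (s - d)) *v \<beta> s) (at (s - d))"
      using N(2)[of "s - d"] s(2) \<open>d \<ge> 0\<close> \<beta>[of s] by auto
    moreover have "((\<lambda>s. s - d) has_vector_derivative 1) (at s)"
      by (auto intro!: derivative_eq_intros)
    ultimately show ?thesis
      using vector_diff_chain_at[of "\<lambda>s. s - d" 1 s x] by (simp add: o_def)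
  qed
  then show "AE s in lebesgue. s \<in> {t + d<..<T} \<longrightarrow>
      ((\<lambda>s. x (s - d)) has_vector_derivative A (x (s - d)) *v \<beta> s) (at s)"
    using negligible_translation[OF N(1), of d] unfolding AE_lebesgue_iff_negligible by blast
qed

section \<open>Square integrable controls under cut-off and delay\<close>

lemma square_integrable_on_indicator:
  fixes \<alpha> :: "real \<Rightarrow> 'a::euclidean_space"
  assumes "square_integrable_on \<alpha> S" "R \<in> sets lebesgue"
  shows "square_integrable_on (\<lambda>s. indicat_real R s *\<^sub>R \<alpha> s) S"
proof -
  \<comment> \<open>Measurability of \<open>\<alpha>\<close> is known only after multiplication by
    the indicator of \<open>S\<close>, so the factor for \<open>R\<close> is applied to that product
    and the two factors are swapped afterwards.\<close>
  have "(\<lambda>s. indicat_real R s *\<^sub>R (indicat_real S s *\<^sub>R \<alpha> s)) \<in> borel_measurable lebesgue"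
    by (rule borel_measurable_scaleR[OF borel_measurable_indicator])
      (use assms in \<open>simp_all add: square_integrable_on_def set_borel_measurable_def\<close>)
  moreover have "integrable lebesgue (\<lambda>s. indicat_real R s *\<^sub>R (indicat_real S s *\<^sub>R (norm (\<alpha> s))\<^sup>2))"
    by (rule integrable_mult_indicator)
      (use assms in \<open>simp_all add: square_integrable_on_def set_integrable_def\<close>)
  moreover have "(\<lambda>s. indicat_real R s *\<^sub>R (indicat_real S s *\<^sub>R \<alpha> s))
      = (\<lambda>s. indicat_real S s *\<^sub>R (indicat_real R s *\<^sub>R \<alpha> s))"
    by (simp add: mult.commute)
  moreover have "(\<lambda>s. indicat_real R s *\<^sub>R (indicat_real S s *\<^sub>R (norm (\<alpha> s))\<^sup>2))
      = (\<lambda>s. indicat_real S s *\<^sub>R (norm (indicat_real R s *\<^sub>R \<alpha> s))\<^sup>2)"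
    by (rule ext) (simp add: indicator_def)
  ultimately show ?thesis
    unfolding square_integrable_on_def set_borel_measurable_def set_integrable_def by simp
qed

text \<open>After the shift, \<open>s - d\<close> may leave \<open>R\<close>, where
  \<open>\<alpha>\<close> is arbitrary; the indicator replaces these values by zero. The rest is
  translation invariance of Lebesgue measure.\<close>

lemma square_integrable_on_delay:
  fixes \<alpha> :: "real \<Rightarrow> 'a::euclidean_space"
  assumes \<alpha>: "square_integrable_on \<alpha> R" and S: "S \<in> sets lebesgue"
  shows "square_integrable_on (\<lambda>s. indicat_real R (s - d) *\<^sub>R \<alpha> (s - d)) S"
proof -
  have "(\<lambda>s. indicat_real R (- d + 1 *\<^sub>R s) *\<^sub>R \<alpha> (- d + 1 *\<^sub>R s)) \<in> borel_measurable lebesgue"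
    using \<alpha> unfolding square_integrable_on_def set_borel_measurable_def
    by (intro borel_measurable_affine[where f = "\<lambda>s. indicat_real R s *\<^sub>R \<alpha> s"]) auto
  then have "set_borel_measurable lebesgue S (\<lambda>s. indicat_real R (s - d) *\<^sub>R \<alpha> (s - d))"
    unfolding set_borel_measurable_def using S
    by (intro borel_measurable_scaleR[OF borel_measurable_indicator]) simp_all
  moreover have "integrable lebesgue (\<lambda>s. indicat_real R (- d + 1 * s) *\<^sub>R (norm (\<alpha> (- d + 1 * s)))\<^sup>2)"
    using \<alpha> unfolding square_integrable_on_def set_integrable_def
    by (intro lebesgue_integrable_real_affine[where f = "\<lambda>s. indicat_real R s *\<^sub>R (norm (\<alpha> s))\<^sup>2"]) auto
  then have "set_integrable lebesgue S (\<lambda>s. indicat_real R (s - d) *\<^sub>R (norm (\<alpha> (s - d)))\<^sup>2)"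
    unfolding set_integrable_def using S by (intro integrable_mult_indicator) simp_all
  moreover have "(\<lambda>s. indicat_real R (s - d) *\<^sub>R (norm (\<alpha> (s - d)))\<^sup>2)
      = (\<lambda>s. (norm (indicat_real R (s - d) *\<^sub>R \<alpha> (s - d)))\<^sup>2)"
    by (rule ext) (simp add: indicator_def)
  ultimately show ?thesis
    unfolding square_integrable_on_def by simp
qed

lemma set_lebesgue_integral_delay:
  fixes f :: "real \<Rightarrow> 'a::euclidean_space"
  shows "(LINT s:{a + d..b + d}|lebesgue. f (s - d)) = (LINT s:{a..b}|lebesgue. f s)"
proof -
  have ind: "indicat_real {a..b} (- d + 1 * s) = indicat_real {a + d..b + d} s" for s
    by (auto simp: indicator_def)
  show ?thesis
    unfolding set_lebesgue_integral_def
    using lebesgue_integral_real_affine[of 1 "\<lambda>s. indicat_real {a..b} s *\<^sub>R f s" "- d"] ind by simp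
qed

section \<open>The sets of costs and their dependence on the initial time\<close>

text \<open>The set whose infimum is the value function, named so that values at two times can be
  compared through relations between two sets.\<close>

definition admissible_costs ::
  "(real^'n \<Rightarrow> real^'n^'n) \<Rightarrow> (real^'n \<Rightarrow> real) \<Rightarrow> real \<Rightarrow> real^'n \<Rightarrow> real \<Rightarrow> real set" where
  "admissible_costs A h T y t =
    {1 / 2 * (LINT s:{t..T}|lebesgue. (norm (\<alpha> s))\<^sup>2) + h (x T) | \<alpha> x.
       square_integrable_on \<alpha> {0..T} \<and> controlled_solution A T y t \<alpha> x}"

lemma admissible_costsI:
  assumes "square_integrable_on \<alpha> {0..T}" "controlled_solution A T y t \<alpha> x"
  shows "1 / 2 * (LINT s:{t..T}|lebesgue. (norm (\<alpha> s))\<^sup>2) + h (x T) \<in> admissible_costs A h T y t"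
  using assms unfolding admissible_costs_def by blast

lemma value_function_eq_Inf: "value_function A h T y t = Inf (admissible_costs A h T y t)"
  by (simp add: value_function_def admissible_costs_def)

lemma admissible_costs_nonempty: "admissible_costs A h T y t \<noteq> {}"
proof -
  have "square_integrable_on (\<lambda>s. 0) {0..T}"
    by (simp add: square_integrable_on_def set_borel_measurable_def set_integrable_def)
  moreover have "controlled_solution A T y t (\<lambda>s. 0) (\<lambda>s. y)"
    by (auto simp: controlled_solution_def abs_cont_on_def intro: exI[of _ 1])
  ultimately show ?thesis unfolding admissible_costs_def by blast
qed

text \<open>The increment bound on all of \<open>{t..T}\<close> shows that the running cost offsets
  any decrease of \<open>h\<close>, up to a constant. Boundedness is what makes the real
  \<open>Inf\<close> a genuine lower bound.\<close>

lemma admissible_costs_bdd_below: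
  fixes A :: "real^'n \<Rightarrow> real^'n^'n"
  assumes bound: "\<And>x \<xi>. norm (A x *v \<xi>) \<le> B * norm \<xi>" and "L \<ge> 0"
    and lip: "\<And>y y'. \<bar>h y - h y'\<bar> \<le> L * norm (y - y')"
    and t: "0 \<le> t" "t \<le> T"
  shows "bdd_below (admissible_costs A h T y t)"
proof (rule bdd_belowI)
  fix c assume "c \<in> admissible_costs A h T y t"
  then obtain \<alpha> x where c: "c = 1 / 2 * (LINT s:{t..T}|lebesgue. (norm (\<alpha> s))\<^sup>2) + h (x T)"
    and \<alpha>: "square_integrable_on \<alpha> {0..T}" and sol: "controlled_solution A T y t \<alpha> x"
    unfolding admissible_costs_def by blast
  have "L * norm (x T - x t)
      \<le> 1 / 2 * (LINT s:{t..T}|lebesgue. (norm (\<alpha> s))\<^sup>2) + (L * B)\<^sup>2 / 2 * (T - t)"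
    by (rule controlled_solution_increment_le[OF bound \<open>L \<ge> 0\<close> sol \<alpha>]) (use t in auto)
  moreover have "\<bar>h (x T) - h (x t)\<bar> \<le> L * norm (x T - x t)" by (rule lip)
  moreover have "x t = y" using sol by (simp add: controlled_solution_def)
  ultimately show "h y - (L * B)\<^sup>2 / 2 * (T - t) \<le> c" unfolding c by auto
qed

text \<open>Waiting until \<open>t'\<close> adds no running cost and leaves the terminal state
  unchanged, so every cost from \<open>t'\<close> is attained exactly from \<open>t\<close>.\<close>

lemma admissible_costs_antimono:
  fixes A :: "real^'n \<Rightarrow> real^'n^'n"
  assumes "t \<le> t'" "t' \<le> T"
  shows "admissible_costs A h T y t' \<subseteq> admissible_costs A h T y t"
proof
  fix c assume "c \<in> admissible_costs A h T y t'"
  then obtain \<alpha> x where c: "c = 1 / 2 * (LINT s:{t'..T}|lebesgue. (norm (\<alpha> s))\<^sup>2) + h (x T)"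
    and \<alpha>: "square_integrable_on \<alpha> {0..T}" and sol: "controlled_solution A T y t' \<alpha> x"
    unfolding admissible_costs_def by blast
  let ?\<beta> = "\<lambda>s. indicat_real {t'..} s *\<^sub>R \<alpha> s"
  have "indicat_real {t..T} s *\<^sub>R (norm (?\<beta> s))\<^sup>2 = indicat_real {t'..T} s *\<^sub>R (norm (\<alpha> s))\<^sup>2" for s
    using \<open>t \<le> t'\<close> by (auto simp: indicator_def)
  then have "c = 1 / 2 * (LINT s:{t..T}|lebesgue. (norm (?\<beta> s))\<^sup>2) + h (x (max t' T))"
    using \<open>t' \<le> T\<close> unfolding c set_lebesgue_integral_def by (simp add: max_def)
  moreover have "square_integrable_on ?\<beta> {0..T}"
    by (rule square_integrable_on_indicator[OF \<alpha>]) simp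
  ultimately show "c \<in> admissible_costs A h T y t"
    using admissible_costsI[OF _ controlled_solution_wait[OF sol assms], of h] by simp
qed

text \<open>The delayed trajectory ends at \<open>x (T - d)\<close>. The running cost saved on
  \<open>{T - d..T}\<close> pays for the change of \<open>h\<close>, up to the constant term of
  Young's inequality.\<close>

lemma admissible_costs_delay:
  fixes A :: "real^'n \<Rightarrow> real^'n^'n"
  assumes bound: "\<And>x \<xi>. norm (A x *v \<xi>) \<le> B * norm \<xi>" and "L \<ge> 0"
    and lip: "\<And>y y'. \<bar>h y - h y'\<bar> \<le> L * norm (y - y')"
    and t: "0 \<le> t" "d \<ge> 0" "t + d \<le> T"
    and c: "c \<in> admissible_costs A h T y t"
  shows "\<exists>c'\<in>admissible_costs A h T y (t + d). c' \<le> c + (L * B)\<^sup>2 / 2 * d"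
proof -
  obtain \<alpha> x where c: "c = 1 / 2 * (LINT s:{t..T}|lebesgue. (norm (\<alpha> s))\<^sup>2) + h (x T)"
    and \<alpha>: "square_integrable_on \<alpha> {0..T}" and sol: "controlled_solution A T y t \<alpha> x"
    using c unfolding admissible_costs_def by blast
  \<comment> \<open>For \<open>s < d\<close> the argument \<open>s - d\<close> is negative and
    \<open>\<alpha>\<close> is unconstrained there. On \<open>{t + d..T}\<close> the cut-off is
    inactive.\<close>
  define \<beta> where "\<beta> s = indicat_real {0..T} (s - d) *\<^sub>R \<alpha> (s - d)" for s
  have \<beta>_eq: "\<beta> s = \<alpha> (s - d)" if "t + d \<le> s" "s \<le> T" for s
    using that t by (simp add: \<beta>_def)
  have \<beta>: "square_integrable_on \<beta> {0..T}"
    unfolding \<beta>_def by (rule square_integrable_on_delay[OF \<alpha>]) simp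
  have sol': "controlled_solution A T y (t + d) \<beta> (\<lambda>s. x (s - d))"
    using \<open>d \<ge> 0\<close> by (intro controlled_solution_delay[OF sol]) (auto simp: \<beta>_eq)
  have "(LINT s:{t + d..T}|lebesgue. (norm (\<beta> s))\<^sup>2)
      = (LINT s:{t + d..T}|lebesgue. (norm (\<alpha> (s - d)))\<^sup>2)"
    by (intro set_lebesgue_integral_cong) (auto simp: \<beta>_eq)
  also have "\<dots> = (LINT s:{t..T - d}|lebesgue. (norm (\<alpha> s))\<^sup>2)"
    using set_lebesgue_integral_delay[of t d "T - d" "\<lambda>s. (norm (\<alpha> s))\<^sup>2"] by simp
  finally have int_\<beta>: "(LINT s:{t + d..T}|lebesgue. (norm (\<beta> s))\<^sup>2)
      = (LINT s:{t..T - d}|lebesgue. (norm (\<alpha> s))\<^sup>2)" .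
  have "set_integrable lebesgue {t..T} (\<lambda>s. (norm (\<alpha> s))\<^sup>2)"
    using t by (intro square_integrable_on_subinterval[OF \<alpha>]) auto
  moreover have "set_integrable lebesgue {t..T - d} (\<lambda>s. (norm (\<alpha> s))\<^sup>2)"
    "set_integrable lebesgue {T - d..T} (\<lambda>s. (norm (\<alpha> s))\<^sup>2)"
    using t by (intro square_integrable_on_subinterval[OF \<alpha>]; auto)+
  ultimately have split: "(LINT s:{t..T}|lebesgue. (norm (\<alpha> s))\<^sup>2)
      = (LINT s:{t..T - d}|lebesgue. (norm (\<alpha> s))\<^sup>2) + (LINT s:{T - d..T}|lebesgue. (norm (\<alpha> s))\<^sup>2)"
    using t Henstock_Kurzweil_Integration.integral_combine[of t "T - d" T "\<lambda>s. (norm (\<alpha> s))\<^sup>2"]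
    by (simp add: set_lebesgue_integral_eq_integral)
  have "L * norm (x T - x (T - d))
      \<le> 1 / 2 * (LINT s:{T - d..T}|lebesgue. (norm (\<alpha> s))\<^sup>2) + (L * B)\<^sup>2 / 2 * (T - (T - d))"
    by (rule controlled_solution_increment_le[OF bound \<open>L \<ge> 0\<close> sol \<alpha>]) (use t in auto)
  moreover have "\<bar>h (x T) - h (x (T - d))\<bar> \<le> L * norm (x T - x (T - d))" by (rule lip)
  ultimately have "1 / 2 * (LINT s:{t + d..T}|lebesgue. (norm (\<beta> s))\<^sup>2) + h (x (T - d))
      \<le> c + (L * B)\<^sup>2 / 2 * d"
    unfolding int_\<beta> c split by (simp add: abs_le_iff algebra_simps)
  then show ?thesis
    using admissible_costsI[OF \<beta> sol', of h] by blast
qed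

section \<open>Lipschitz continuity of the value function in time\<close>

lemma value_function_time_increment:
  fixes A :: "real^'n \<Rightarrow> real^'n^'n"
  assumes bound: "\<And>x \<xi>. norm (A x *v \<xi>) \<le> B * norm \<xi>" and "L \<ge> 0"
    and lip: "\<And>y y'. \<bar>h y - h y'\<bar> \<le> L * norm (y - y')"
    and t: "0 \<le> t" "t \<le> t'" "t' \<le> T"
  shows "\<bar>value_function A h T y t - value_function A h T y t'\<bar> \<le> (L * B)\<^sup>2 / 2 * (t' - t)"
proof -
  have bdd: "bdd_below (admissible_costs A h T y s)" if "0 \<le> s" "s \<le> T" for s
    by (rule admissible_costs_bdd_below[OF bound \<open>L \<ge> 0\<close> lip that])
  have "value_function A h T y t \<le> value_function A h T y t'"
    unfolding value_function_eq_Inf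
    using t by (intro cInf_superset_mono admissible_costs_nonempty bdd admissible_costs_antimono) auto
  \<comment> \<open>Each cost \<open>c\<close> from \<open>t\<close> is matched by a cost
    \<open>c'\<close> from \<open>t'\<close> with controlled excess, and the bound passes to the
    infimum over \<open>c\<close>.\<close>
  moreover have "value_function A h T y t' - (L * B)\<^sup>2 / 2 * (t' - t) \<le> value_function A h T y t"
    unfolding value_function_eq_Inf[of A h T y t]
  proof (rule cInf_greatest[OF admissible_costs_nonempty])
    fix c assume c: "c \<in> admissible_costs A h T y t"
    obtain c' where c': "c' \<in> admissible_costs A h T y t'" "c' \<le> c + (L * B)\<^sup>2 / 2 * (t' - t)"
      using admissible_costs_delay[OF bound \<open>L \<ge> 0\<close> lip _ _ _ c, of "t' - t"] t by auto
    moreover have "value_function A h T y t' \<le> c'"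
      unfolding value_function_eq_Inf using t by (intro cInf_lower c' bdd) auto
    ultimately show "value_function A h T y t' - (L * B)\<^sup>2 / 2 * (t' - t) \<le> c" by linarith
  qed
  ultimately show ?thesis by linarith
qed

theorem theorem3:
  fixes A :: "real^'n \<Rightarrow> real^'n^'n" and h :: "real^'n \<Rightarrow> real" and T B L :: real
  assumes "T > 0"
    and "continuous_on UNIV A"
    and "B > 0"
    and "\<And>x \<xi>. norm (A x *v \<xi>) \<le> B * norm \<xi>"
    and "\<And>y y'. \<bar>h y - h y'\<bar> \<le> L * norm (y - y')"
  shows "\<exists>k>0. \<forall>y. \<forall>t\<in>{0..T}. \<forall>t'\<in>{0..T}.
           \<bar>value_function A h T y t - value_function A h T y t'\<bar> \<le> k * \<bar>t - t'\<bar>"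
proof (intro exI conjI allI ballI)
  \<comment> \<open>The sign of \<open>L\<close> follows from the Lipschitz bound at a unit vector
    and the origin; \<open>undefined\<close> merely picks some coordinate.\<close>
  have "0 \<le> L * norm (axis undefined 1 - 0 :: real^'n)"
    by (rule order_trans[OF abs_ge_zero assms(5)])
  then have "L \<ge> 0" by (simp add: norm_axis_1)
  note incr = value_function_time_increment[OF assms(4) \<open>L \<ge> 0\<close> assms(5)]
  \<comment> \<open>The summand 1 makes the constant positive even when
    \<open>L = 0\<close>.\<close>
  let ?k = "(L * B)\<^sup>2 / 2 + 1"
  show "?k > 0" by (simp add: add_nonneg_pos)
  fix y t t' assume t: "t \<in> {0..T}" "t' \<in> {0..T}"
  have "\<bar>value_function A h T y t - value_function A h T y t'\<bar> \<le> (L * B)\<^sup>2 / 2 * \<bar>t - t'\<bar>"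
  proof (cases "t \<le> t'")
    case True
    then show ?thesis using incr[where t = t and t' = t' and T = T and y = y] t by simp
  next
    case False
    then show ?thesis using incr[where t = t' and t' = t and T = T and y = y] t
      by (simp add: abs_minus_commute[of "value_function A h T y t"])
  qed
  also have "\<dots> \<le> ?k * \<bar>t - t'\<bar>" by (intro mult_right_mono) auto
  finally show "\<bar>value_function A h T y t - value_function A h T y t'\<bar> \<le> ?k * \<bar>t - t'\<bar>" .
qed

end
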